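(* Let $\mathbb{K}$ be an algebraically closed field of characteristic zero. Every $A$-covered algebraic variety over $\mathbb{K}$ is an $A$-image.
   Context: An algebraic variety $X$ is an $A$-image if for some positive integer $m$ there is a surjective morphism $\varphi\colon \mathbb{A}^m\to X$. An irreducible algebraic variety $X$ is $A$-covered if there is an open covering $X=U_1\cup\ldots\cup U_r$ where every $U_i$ is isomorphic to the affine space $\mathbb{A}^n$ (with $n=\dim X$). *)

theory Defs
  imports "HOL-Computational_Algebra.Polynomial"
begin

text \<open>A point of the affine space A^n over 'k is represented as a function
  nat => 'k vanishing at all indices >= n.\<close>

definition aff :: "nat \<Rightarrow> (nat \<Rightarrow> 'k::field) set" where
  "aff n = {x. \<forall>k\<ge>n. x k = 0}"

inductive_set polyfun :: "nat \<Rightarrow> ((nat \<Rightarrow> 'k::field) \<Rightarrow> 'k) set" for n :: nat where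
  const: "(\<lambda>x. c) \<in> polyfun n"
| var: "i < n \<Longrightarrow> (\<lambda>x. x i) \<in> polyfun n"
| add: "f \<in> polyfun n \<Longrightarrow> g \<in> polyfun n \<Longrightarrow> (\<lambda>x. f x + g x) \<in> polyfun n"
| mult: "f \<in> polyfun n \<Longrightarrow> g \<in> polyfun n \<Longrightarrow> (\<lambda>x. f x * g x) \<in> polyfun n"

definition zclosed :: "nat \<Rightarrow> (nat \<Rightarrow> 'k::field) set \<Rightarrow> bool" where
  "zclosed n Z \<longleftrightarrow> (\<exists>F \<subseteq> polyfun n. Z = {x \<in> aff n. \<forall>f\<in>F. f x = 0})"

definition zopen :: "nat \<Rightarrow> (nat \<Rightarrow> 'k::field) set \<Rightarrow> bool" where
  "zopen n U \<longleftrightarrow> U \<subseteq> aff n \<and> zclosed n (aff n - U)"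

definition regular_on :: "nat \<Rightarrow> (nat \<Rightarrow> 'k::field) set \<Rightarrow> ((nat \<Rightarrow> 'k) \<Rightarrow> 'k) \<Rightarrow> bool" where
  "regular_on n W f \<longleftrightarrow>
     (\<forall>p\<in>W. \<exists>V g h. zopen n V \<and> p \<in> V \<and> V \<subseteq> W \<and> g \<in> polyfun n \<and> h \<in> polyfun n \<and>
        (\<forall>x\<in>V. h x \<noteq> 0 \<and> f x = g x / h x))"

definition regular_map_on :: "nat \<Rightarrow> nat \<Rightarrow> (nat \<Rightarrow> 'k::field) set \<Rightarrow> ((nat \<Rightarrow> 'k) \<Rightarrow> (nat \<Rightarrow> 'k)) \<Rightarrow> bool" where
  "regular_map_on m n W F \<longleftrightarrow> zopen m W \<and> F ` W \<subseteq> aff n \<and> (\<forall>k<n. regular_on m W (\<lambda>x. F x k))"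

text \<open>Point of A^(n+n) obtained from two points of A^n (identification A^n x A^n = A^(2n)).\<close>

definition glue :: "nat \<Rightarrow> (nat \<Rightarrow> 'k) \<Rightarrow> (nat \<Rightarrow> 'k) \<Rightarrow> (nat \<Rightarrow> 'k::field)" where
  "glue n x y = (\<lambda>k. if k < n then x k else y (k - n))"

text \<open>An atlas \<phi>_0,...,\<phi>_(r-1) : A^n -> X presents X as a (separated) algebraic variety
  covered by open charts U_i = \<phi>_i(A^n) each isomorphic to A^n.\<close>

definition chart_dom :: "nat \<Rightarrow> (nat \<Rightarrow> (nat \<Rightarrow> 'k::field) \<Rightarrow> 'a) \<Rightarrow> nat \<Rightarrow> nat \<Rightarrow> (nat \<Rightarrow> 'k) set" where
  "chart_dom n \<phi> i j = {x \<in> aff n. \<phi> i x \<in> \<phi> j ` aff n}"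

definition aff_atlas :: "'a set \<Rightarrow> nat \<Rightarrow> nat \<Rightarrow> (nat \<Rightarrow> (nat \<Rightarrow> 'k::field) \<Rightarrow> 'a) \<Rightarrow> bool" where
  "aff_atlas X n r \<phi> \<longleftrightarrow>
     0 < r \<and>
     X = (\<Union>i<r. \<phi> i ` aff n) \<and>
     (\<forall>i<r. inj_on (\<phi> i) (aff n)) \<and>
     (\<forall>i<r. \<forall>j<r. regular_map_on n n (chart_dom n \<phi> i j)
                     (\<lambda>x. inv_into (aff n) (\<phi> j) (\<phi> i x))) \<and>
     (\<forall>i<r. \<forall>j<r. zclosed (n + n) {glue n x y | x y. x \<in> aff n \<and> y \<in> aff n \<and> \<phi> i x = \<phi> j y})"

definition xopen :: "'a set \<Rightarrow> nat \<Rightarrow> nat \<Rightarrow> (nat \<Rightarrow> (nat \<Rightarrow> 'k::field) \<Rightarrow> 'a) \<Rightarrow> 'a set \<Rightarrow> bool" where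
  "xopen X n r \<phi> U \<longleftrightarrow> U \<subseteq> X \<and> (\<forall>i<r. zopen n {x \<in> aff n. \<phi> i x \<in> U})"

definition xclosed :: "'a set \<Rightarrow> nat \<Rightarrow> nat \<Rightarrow> (nat \<Rightarrow> (nat \<Rightarrow> 'k::field) \<Rightarrow> 'a) \<Rightarrow> 'a set \<Rightarrow> bool" where
  "xclosed X n r \<phi> Z \<longleftrightarrow> Z \<subseteq> X \<and> xopen X n r \<phi> (X - Z)"

definition irreducible_var :: "'a set \<Rightarrow> nat \<Rightarrow> nat \<Rightarrow> (nat \<Rightarrow> (nat \<Rightarrow> 'k::field) \<Rightarrow> 'a) \<Rightarrow> bool" where
  "irreducible_var X n r \<phi> \<longleftrightarrow> X \<noteq> {} \<and>
     (\<forall>Z1 Z2. xclosed X n r \<phi> Z1 \<and> xclosed X n r \<phi> Z2 \<and> X = Z1 \<union> Z2 \<longrightarrow> Z1 = X \<or> Z2 = X)"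

definition A_covered :: "'a set \<Rightarrow> nat \<Rightarrow> nat \<Rightarrow> (nat \<Rightarrow> (nat \<Rightarrow> 'k::field) \<Rightarrow> 'a) \<Rightarrow> bool" where
  "A_covered X n r \<phi> \<longleftrightarrow> aff_atlas X n r \<phi> \<and> irreducible_var X n r \<phi>"

definition morphism_to :: "nat \<Rightarrow> 'a set \<Rightarrow> nat \<Rightarrow> nat \<Rightarrow> (nat \<Rightarrow> (nat \<Rightarrow> 'k::field) \<Rightarrow> 'a)
                          \<Rightarrow> ((nat \<Rightarrow> 'k) \<Rightarrow> 'a) \<Rightarrow> bool" where
  "morphism_to m X n r \<phi> \<psi> \<longleftrightarrow>
     \<psi> ` aff m \<subseteq> X \<and>
     (\<forall>U. xopen X n r \<phi> U \<longrightarrow> zopen m {p \<in> aff m. \<psi> p \<in> U}) \<and>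
     (\<forall>i<r. regular_map_on m n {p \<in> aff m. \<psi> p \<in> \<phi> i ` aff n}
                (\<lambda>p. inv_into (aff n) (\<phi> i) (\<psi> p)))"

definition A_image :: "'a set \<Rightarrow> nat \<Rightarrow> nat \<Rightarrow> (nat \<Rightarrow> (nat \<Rightarrow> 'k::field) \<Rightarrow> 'a) \<Rightarrow> bool" where
  "A_image X n r \<phi> \<longleftrightarrow> (\<exists>m>0. \<exists>\<psi>. morphism_to m X n r \<phi> \<psi> \<and> \<psi> ` aff m = X)"

definition alg_closed_field :: "'k::field itself \<Rightarrow> bool" where
  "alg_closed_field _ \<longleftrightarrow> (\<forall>p :: 'k poly. degree p \<noteq> 0 \<longrightarrow> (\<exists>x. poly p x = 0))"

end

theory Submission
  imports Defs
begin

text \<open>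
  Let \<open>\<psi> : A^m \<rightarrow> X\<close> be a morphism whose image contains the chart \<open>U_0\<close>, and let \<open>U_i\<close> be another
  chart. On some nonempty principal open set \<open>D(h)\<close> of \<open>A^m\<close> the morphism has image in \<open>U_i\<close> and is
  given by \<open>q = G/h\<close> in the coordinates of \<open>U_i\<close>. Translating in these coordinates gives a
  map \<open>(p, v) \<mapsto> \<phi>_i (q p + w p \<cdot> v)\<close>, which is onto \<open>U_i\<close> already over a single point \<open>p\<close> with \<open>w p \<noteq> 0\<close>.
  If the factor \<open>w\<close> vanishes to sufficiently high order along a suitable hypersurface \<open>u = 0\<close>, then
  in every other chart the translation reads \<open>y \<mapsto> (y + u B')/(1 + u B)\<close> with polynomials \<open>B\<close>, \<open>B'\<close>,
  so it extends by \<open>\<psi>\<close> to a morphism \<open>A^(m+n) \<rightarrow> X\<close>. Its image contains \<open>U_i\<close> and the image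
  of \<open>\<psi>\<close>. Running through all charts makes the morphism surjective.
\<close>

subsection \<open>Polynomial functions\<close>

lemma polyfun_power: "f \<in> polyfun n \<Longrightarrow> (\<lambda>x. f x ^ k) \<in> polyfun n"
  by (induction k) (auto intro: polyfun.intros)

lemma polyfun_prod:
  "(\<And>s. s \<in> S \<Longrightarrow> f s \<in> polyfun n) \<Longrightarrow> (\<lambda>x. \<Prod>s\<in>S. f s x) \<in> polyfun n"
  by (induction S rule: infinite_finite_induct) (auto intro: polyfun.intros)

lemma polyfun_mono: "f \<in> polyfun n \<Longrightarrow> n \<le> m \<Longrightarrow> f \<in> polyfun m"
  by (induction rule: polyfun.induct) (auto intro: polyfun.intros)

text \<open>Polynomial functions live on all sequences, not only on \<open>aff n\<close>. Hence a
  polynomial in \<open>m\<close> variables can be evaluated directly at a point of A^(m+n), with the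
  same value as at its truncation to A^m.\<close>

lemma polyfun_cong: "f \<in> polyfun n \<Longrightarrow> (\<And>k. k < n \<Longrightarrow> x k = y k) \<Longrightarrow> f x = f y"
  by (induction rule: polyfun.induct) auto

text \<open>Restriction to the line through \<open>x\<close> and \<open>y\<close> reduces questions
  about nonvanishing to roots of polynomials in one variable.\<close>

lemma polyfun_on_line:
  assumes "f \<in> polyfun n"
  shows "\<exists>P. \<forall>t. f (\<lambda>k. x k + t * (y k - x k)) = poly P t"
  using assms
proof (induction rule: polyfun.induct)
  case (const c)
  show ?case by (rule exI[of _ "[:c:]"]) simp
next
  case (var i)
  show ?case by (rule exI[of _ "[:x i, y i - x i:]"]) simp
next
  case (add f g)
  then show ?case by (metis poly_add)
next
  case (mult f g)
  then show ?case by (metis poly_mult)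
qed

text \<open>On the line joining \<open>x\<close> and \<open>y\<close> both functions become
  polynomials in one variable, nonzero at the parameters 0 and 1 respectively. Their product has
  finitely many roots, and a field of characteristic zero is infinite.\<close>

lemma polyfun_common_nonzero:
  fixes f g :: "(nat \<Rightarrow> 'k::field_char_0) \<Rightarrow> 'k"
  assumes f: "f \<in> polyfun n" "x \<in> aff n" "f x \<noteq> 0"
    and g: "g \<in> polyfun n" "y \<in> aff n" "g y \<noteq> 0"
  shows "\<exists>z\<in>aff n. f z \<noteq> 0 \<and> g z \<noteq> 0"
proof -
  define l where "l = (\<lambda>t k. x k + t * (y k - x k))"
  obtain P where P: "\<And>t. f (l t) = poly P t"
    using polyfun_on_line[OF f(1), of x y] unfolding l_def by blast
  obtain Q where Q: "\<And>t. g (l t) = poly Q t"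
    using polyfun_on_line[OF g(1), of x y] unfolding l_def by blast
  have "l 0 = x" "l 1 = y" by (auto simp: l_def)
  then have "P * Q \<noteq> 0" using P[of 0] Q[of 1] f g by auto
  then have "finite {t. poly (P * Q) t = 0}" by (rule poly_roots_finite)
  then obtain t where "poly (P * Q) t \<noteq> 0"
    using infinite_UNIV_char_0[where 'a='k] by (metis (mono_tags) UNIV_eq_I mem_Collect_eq)
  then have "f (l t) \<noteq> 0" "g (l t) \<noteq> 0" by (simp_all add: P Q)
  moreover have "l t \<in> aff n" using f g by (auto simp: l_def aff_def)
  ultimately show ?thesis by blast
qed

text \<open>The product of all \<open>h s\<close> serves as \<open>c\<close>, with the product of
  the other factors as cofactor. It brings finitely many fractions over one denominator that is
  still nonzero at \<open>p\<close>.\<close>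

lemma polyfun_common_multiple:
  assumes "finite S" and h: "\<And>s. s \<in> S \<Longrightarrow> h s \<in> polyfun n \<and> h s p \<noteq> 0"
  shows "\<exists>c\<in>polyfun n. c p \<noteq> 0 \<and> (\<forall>s\<in>S. \<exists>d\<in>polyfun n. \<forall>x. c x = d x * h s x)"
proof (rule bexI[of _ "\<lambda>x. \<Prod>s\<in>S. h s x"], intro conjI ballI)
  show "(\<lambda>x. \<Prod>s\<in>S. h s x) \<in> polyfun n" using h by (intro polyfun_prod) auto
  show "(\<Prod>s\<in>S. h s p) \<noteq> 0" using assms by simp
  fix s assume s: "s \<in> S"
  have "(\<lambda>x. \<Prod>r\<in>S-{s}. h r x) \<in> polyfun n" using h by (intro polyfun_prod) auto
  moreover have "(\<Prod>s\<in>S. h s x) = (\<Prod>r\<in>S-{s}. h r x) * h s x" for x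
    using prod.remove[OF assms(1) s] by (simp add: mult.commute)
  ultimately show "\<exists>d\<in>polyfun n. \<forall>x. (\<Prod>s\<in>S. h s x) = d x * h s x"
    by (intro bexI[of _ "\<lambda>x. \<Prod>r\<in>S-{s}. h r x"]) auto
qed

subsection \<open>Open sets and regular maps through principal open sets\<close>

lemma zopen_iff:
  "zopen n U \<longleftrightarrow> U \<subseteq> aff n \<and>
     (\<forall>p\<in>U. \<exists>f\<in>polyfun n. f p \<noteq> 0 \<and> (\<forall>x\<in>aff n. f x \<noteq> 0 \<longrightarrow> x \<in> U))"
proof
  assume "zopen n U"
  then obtain F where U: "U \<subseteq> aff n" and F: "F \<subseteq> polyfun n"
    and eq: "aff n - U = {x \<in> aff n. \<forall>f\<in>F. f x = 0}"
    unfolding zopen_def zclosed_def by blast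
  have "\<exists>f\<in>polyfun n. f p \<noteq> 0 \<and> (\<forall>x\<in>aff n. f x \<noteq> 0 \<longrightarrow> x \<in> U)" if p: "p \<in> U" for p
  proof -
    have "p \<notin> {x \<in> aff n. \<forall>f\<in>F. f x = 0}" using p eq by blast
    then obtain f where f: "f \<in> F" "f p \<noteq> 0" using p U by blast
    then show ?thesis using eq F by blast
  qed
  then show "U \<subseteq> aff n \<and> (\<forall>p\<in>U. \<exists>f\<in>polyfun n. f p \<noteq> 0 \<and> (\<forall>x\<in>aff n. f x \<noteq> 0 \<longrightarrow> x \<in> U))"
    using U by blast
next
  assume *: "U \<subseteq> aff n \<and> (\<forall>p\<in>U. \<exists>f\<in>polyfun n. f p \<noteq> 0 \<and> (\<forall>x\<in>aff n. f x \<noteq> 0 \<longrightarrow> x \<in> U))"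
  \<comment> \<open>The largest candidate system of equations: all polynomials vanishing on the
    complement of \<open>U\<close>.\<close>
  define F where "F = {f \<in> polyfun n. \<forall>x\<in>aff n. f x \<noteq> 0 \<longrightarrow> x \<in> U}"
  have "aff n - U = {x \<in> aff n. \<forall>f\<in>F. f x = 0}"
    using * unfolding F_def by blast
  moreover have "F \<subseteq> polyfun n" by (auto simp: F_def)
  ultimately show "zopen n U" using * unfolding zopen_def zclosed_def by blast
qed

lemma zopenE:
  assumes "zopen n U" "p \<in> U"
  obtains f where "p \<in> aff n" "f \<in> polyfun n" "f p \<noteq> 0" "\<And>x. x \<in> aff n \<Longrightarrow> f x \<noteq> 0 \<Longrightarrow> x \<in> U"
  using assms unfolding zopen_iff by blast

text \<open>This is the irreducibility of affine space; shrinking both sets to principal open ones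
  reduces it to \<open>polyfun_common_nonzero\<close>.\<close>

lemma zopen_Int_nonempty:
  fixes U V :: "(nat \<Rightarrow> 'k::field_char_0) set"
  assumes "zopen n U" "zopen n V" "U \<noteq> {}" "V \<noteq> {}"
  shows "U \<inter> V \<noteq> {}"
proof -
  obtain p q where p: "p \<in> U" and q: "q \<in> V" using assms by blast
  obtain f where f: "p \<in> aff n" "f \<in> polyfun n" "f p \<noteq> 0" "\<And>x. x \<in> aff n \<Longrightarrow> f x \<noteq> 0 \<Longrightarrow> x \<in> U"
    using zopenE[OF assms(1) p] by blast
  obtain g where g: "q \<in> aff n" "g \<in> polyfun n" "g q \<noteq> 0" "\<And>x. x \<in> aff n \<Longrightarrow> g x \<noteq> 0 \<Longrightarrow> x \<in> V"
    using zopenE[OF assms(2) q] by blast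
  show ?thesis using polyfun_common_nonzero[OF f(2,1,3) g(2,1,3)] f(4) g(4) by blast
qed

lemma zopen_Int:
  assumes "zopen n U" "zopen n V"
  shows "zopen n (U \<inter> V)"
  unfolding zopen_iff
proof (intro conjI ballI)
  show "U \<inter> V \<subseteq> aff n" using assms by (auto simp: zopen_def)
  fix p assume p: "p \<in> U \<inter> V"
  obtain f where f: "f \<in> polyfun n" "f p \<noteq> 0" "\<And>x. x \<in> aff n \<Longrightarrow> f x \<noteq> 0 \<Longrightarrow> x \<in> U"
    using zopenE[OF assms(1)] p by blast
  obtain g where g: "g \<in> polyfun n" "g p \<noteq> 0" "\<And>x. x \<in> aff n \<Longrightarrow> g x \<noteq> 0 \<Longrightarrow> x \<in> V"
    using zopenE[OF assms(2)] p by blast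
  show "\<exists>f\<in>polyfun n. f p \<noteq> 0 \<and> (\<forall>x\<in>aff n. f x \<noteq> 0 \<longrightarrow> x \<in> U \<inter> V)"
    using f g by (intro bexI[of _ "\<lambda>x. f x * g x"]) (auto intro: polyfun.mult)
qed

lemma zopen_INT_nonempty:
  fixes U :: "nat \<Rightarrow> (nat \<Rightarrow> 'k::field_char_0) set"
  assumes "\<And>j. j < r \<Longrightarrow> zopen n (U j) \<and> U j \<noteq> {}"
  shows "\<exists>z\<in>aff n. \<forall>j<r. z \<in> U j"
proof -
  \<comment> \<open>The factor \<open>aff n\<close> keeps the intersection inside affine space when
    \<open>r = 0\<close>; openness is carried along because the induction step needs it.\<close>
  have "zopen n (aff n \<inter> (\<Inter>j<r. U j)) \<and> aff n \<inter> (\<Inter>j<r. U j) \<noteq> {}"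
    using assms
  proof (induction r)
    case 0
    have "zopen n (aff n :: (nat \<Rightarrow> 'k) set)" unfolding zopen_iff
      by (auto intro: bexI[of _ "\<lambda>x. 1"] polyfun.const)
    moreover have "(\<lambda>k. 0) \<in> aff n" by (simp add: aff_def)
    ultimately show ?case by auto
  next
    case (Suc r)
    have eq: "aff n \<inter> (\<Inter>j<Suc r. U j) = (aff n \<inter> (\<Inter>j<r. U j)) \<inter> U r"
      by (auto simp: lessThan_Suc)
    have *: "zopen n (aff n \<inter> (\<Inter>j<r. U j))" "zopen n (U r)"
        "aff n \<inter> (\<Inter>j<r. U j) \<noteq> {}" "U r \<noteq> {}"
      using Suc by (meson lessI less_SucI)+
    show ?case unfolding eq using zopen_Int[OF *(1,2)] zopen_Int_nonempty[OF *] by (rule conjI)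
  qed
  then show ?thesis by auto
qed

text \<open>Multiplying numerator and denominator by a polynomial \<open>d\<close> that cuts out a
  principal open set inside \<open>V\<close> turns the nonvanishing locus of the denominator into
  the neighbourhood itself. No separate open set has to be carried.\<close>

lemma regular_on_iff:
  "regular_on n W f \<longleftrightarrow>
     (\<forall>p\<in>W. \<exists>g\<in>polyfun n. \<exists>h\<in>polyfun n. p \<in> aff n \<and> h p \<noteq> 0 \<and>
        (\<forall>x\<in>aff n. h x \<noteq> 0 \<longrightarrow> x \<in> W \<and> f x = g x / h x))"
proof
  assume reg: "regular_on n W f"
  show "\<forall>p\<in>W. \<exists>g\<in>polyfun n. \<exists>h\<in>polyfun n. p \<in> aff n \<and> h p \<noteq> 0 \<and>
        (\<forall>x\<in>aff n. h x \<noteq> 0 \<longrightarrow> x \<in> W \<and> f x = g x / h x)"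
  proof
    fix p assume "p \<in> W"
    then obtain V g h where V: "zopen n V" "p \<in> V" "V \<subseteq> W" and gh: "g \<in> polyfun n" "h \<in> polyfun n"
      and f: "\<forall>x\<in>V. h x \<noteq> 0 \<and> f x = g x / h x"
      using reg unfolding regular_on_def by meson
    obtain d where d: "d \<in> polyfun n" "d p \<noteq> 0" "\<forall>x\<in>aff n. d x \<noteq> 0 \<longrightarrow> x \<in> V"
      using V unfolding zopen_iff by blast
    have "p \<in> aff n" using V by (auto simp: zopen_def)
    then show "\<exists>g\<in>polyfun n. \<exists>h\<in>polyfun n. p \<in> aff n \<and> h p \<noteq> 0 \<and>
        (\<forall>x\<in>aff n. h x \<noteq> 0 \<longrightarrow> x \<in> W \<and> f x = g x / h x)"
      using V d gh f
      by (intro bexI[of _ "\<lambda>x. g x * d x"] bexI[of _ "\<lambda>x. h x * d x"] polyfun.mult) auto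
  qed
next
  assume *: "\<forall>p\<in>W. \<exists>g\<in>polyfun n. \<exists>h\<in>polyfun n. p \<in> aff n \<and> h p \<noteq> 0 \<and>
        (\<forall>x\<in>aff n. h x \<noteq> 0 \<longrightarrow> x \<in> W \<and> f x = g x / h x)"
  show "regular_on n W f" unfolding regular_on_def
  proof
    fix p assume "p \<in> W"
    then obtain g h where gh: "g \<in> polyfun n" "h \<in> polyfun n" "p \<in> aff n" "h p \<noteq> 0"
      and f: "\<forall>x\<in>aff n. h x \<noteq> 0 \<longrightarrow> x \<in> W \<and> f x = g x / h x"
      using * by meson
    have "zopen n {x \<in> aff n. h x \<noteq> 0}" unfolding zopen_iff using gh by blast
    then show "\<exists>V g h. zopen n V \<and> p \<in> V \<and> V \<subseteq> W \<and> g \<in> polyfun n \<and> h \<in> polyfun n \<and>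
        (\<forall>x\<in>V. h x \<noteq> 0 \<and> f x = g x / h x)"
      using gh f by (intro exI[of _ "{x \<in> aff n. h x \<noteq> 0}"] exI[of _ g] exI[of _ h]) auto
  qed
qed

section \<open>Rational maps over a common denominator\<close>

definition frac_map ::
  "nat \<Rightarrow> (nat \<Rightarrow> (nat \<Rightarrow> 'k) \<Rightarrow> 'k) \<Rightarrow> ((nat \<Rightarrow> 'k) \<Rightarrow> 'k) \<Rightarrow> (nat \<Rightarrow> 'k) \<Rightarrow> (nat \<Rightarrow> 'k::field)" where
  "frac_map n G h x = (\<lambda>a. if a < n then G a x / h x else 0)"

text \<open>True also where \<open>h\<close> vanishes, since the coordinates from \<open>n\<close>
  on are set to zero; compositions therefore need no side condition here.\<close>

lemma frac_map_in_aff [simp]: "frac_map n G h x \<in> aff n"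
  by (simp add: frac_map_def aff_def)

lemma regular_map_common_denominator:
  assumes reg: "regular_map_on m n W F" and p: "p \<in> W"
  shows "\<exists>G. \<exists>h\<in>polyfun m. (\<forall>a<n. G a \<in> polyfun m) \<and> h p \<noteq> 0 \<and>
           (\<forall>x\<in>aff m. h x \<noteq> 0 \<longrightarrow> x \<in> W \<and> F x = frac_map n G h x)"
proof -
  have W: "zopen m W" and FW: "F ` W \<subseteq> aff n" using reg by (auto simp: regular_map_on_def)
  \<comment> \<open>For \<open>n = 0\<close> no coordinate supplies a neighbourhood, so the one
    inside \<open>W\<close> is taken from the openness of \<open>W\<close>. The polynomial
    \<open>w\<close> will multiply numerators and denominator alike.\<close>
  obtain w where w: "w \<in> polyfun m" "w p \<noteq> 0" "\<forall>x\<in>aff m. w x \<noteq> 0 \<longrightarrow> x \<in> W"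
    using W p unfolding zopen_iff by blast
  have "\<exists>g h. a < n \<longrightarrow> g \<in> polyfun m \<and> h \<in> polyfun m \<and> h p \<noteq> 0 \<and>
           (\<forall>x\<in>aff m. h x \<noteq> 0 \<longrightarrow> F x a = g x / h x)" for a
  proof (cases "a < n")
    case True
    then have "regular_on m W (\<lambda>x. F x a)" using reg by (simp add: regular_map_on_def)
    then show ?thesis using p unfolding regular_on_iff by blast
  qed simp
  then obtain g h where gh: "\<And>a. a < n \<Longrightarrow> g a \<in> polyfun m \<and> h a \<in> polyfun m \<and> h a p \<noteq> 0 \<and>
           (\<forall>x\<in>aff m. h a x \<noteq> 0 \<longrightarrow> F x a = g a x / h a x)"
    by metis
  obtain c where c: "c \<in> polyfun m" "c p \<noteq> 0"
      "\<forall>a\<in>{..<n}. \<exists>d\<in>polyfun m. \<forall>x. c x = d x * h a x"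
    using polyfun_common_multiple[of "{..<n}" h m p] gh by auto
  then obtain d where d: "\<And>a. a < n \<Longrightarrow> d a \<in> polyfun m \<and> (\<forall>x. c x = d a x * h a x)"
    by (metis lessThan_iff)
  show ?thesis
  proof (intro exI[of _ "\<lambda>a x. g a x * d a x * w x"] bexI[of _ "\<lambda>x. w x * c x"]
      conjI ballI impI allI)
    show "(\<lambda>x. w x * c x) \<in> polyfun m" using w c by (auto intro: polyfun.mult)
    show "w p * c p \<noteq> 0" using w c by simp
    show "(\<lambda>x. g a x * d a x * w x) \<in> polyfun m" if "a < n" for a
      using gh d w that by (auto intro!: polyfun.mult)
    fix x assume x: "x \<in> aff m" "w x * c x \<noteq> 0"
    then show "x \<in> W" using w by auto
    then have "F x \<in> aff n" using FW by blast
    moreover have "F x a = g a x * d a x * w x / (w x * c x)" if "a < n" for a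
    proof -
      have "h a x \<noteq> 0" "d a x \<noteq> 0" "c x = d a x * h a x" using x d[OF that] by auto
      then show ?thesis using gh[OF that] x by (simp add: field_simps)
    qed
    ultimately show "F x = frac_map n (\<lambda>a x. g a x * d a x * w x) (\<lambda>x. w x * c x) x"
      by (auto simp: frac_map_def aff_def)
  qed
qed

text \<open>
  The numerator \<open>A\<close> does not depend on \<open>t\<close>, so \<open>t = 0\<close> identifies it with the numerator
  of \<open>e \<circ> (G/h)\<close>. The exponent \<open>K\<close> is left free so that it can be chosen uniformly
  for finitely many \<open>e\<close>.
\<close>

lemma polyfun_translated_frac_map:
  assumes e: "e \<in> polyfun n" and G: "\<And>a. a < n \<Longrightarrow> G a \<in> polyfun m" and h: "h \<in> polyfun m"
  shows "\<forall>\<^sub>F K in sequentially. \<exists>A\<in>polyfun m. \<forall>t\<in>polyfun m. \<exists>B\<in>polyfun (m + n). \<forall>x. h x \<noteq> 0 \<longrightarrow>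
      e (frac_map n (\<lambda>a x. G a x + t x * x (m + a)) h x) * h x ^ K = A x + t x * B x"
proof -
  have G': "G a \<in> polyfun (m + n)" if "a < n" for a using polyfun_mono[OF G[OF that]] by simp
  have h': "h \<in> polyfun (m + n)" using polyfun_mono[OF h] by simp
  let ?q = "\<lambda>t x. frac_map n (\<lambda>a x. G a x + t x * x (m + a)) h x"
  let ?P = "\<lambda>e K. \<exists>A\<in>polyfun m. \<forall>t\<in>polyfun m. \<exists>B\<in>polyfun (m + n). \<forall>x. h x \<noteq> 0 \<longrightarrow>
      e (?q t x) * h x ^ K = A x + t x * B x"
  \<comment> \<open>Exponents can be raised: multiply \<open>A\<close> and \<open>B\<close> by a
    power of \<open>h\<close>. Sums use this to reach a common exponent, and the eventual statement
    uses it for all large \<open>K\<close>.\<close>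
  have step: "?P e (k + l)" if Pk: "?P e k" for e k l
  proof -
    obtain A where A: "A \<in> polyfun m" "\<forall>t\<in>polyfun m. \<exists>B\<in>polyfun (m + n). \<forall>x. h x \<noteq> 0 \<longrightarrow>
      e (?q t x) * h x ^ k = A x + t x * B x" using Pk by blast
    show ?thesis
    proof (rule bexI, rule ballI)
      show "(\<lambda>x. A x * h x ^ l) \<in> polyfun m" by (intro polyfun.mult polyfun_power A h)
      fix t :: "(nat \<Rightarrow> 'a) \<Rightarrow> 'a" assume "t \<in> polyfun m"
      then obtain B where B: "B \<in> polyfun (m + n)"
        "\<And>x. h x \<noteq> 0 \<Longrightarrow> e (?q t x) * h x ^ k = A x + t x * B x" using A by blast
      show "\<exists>B\<in>polyfun (m + n). \<forall>x. h x \<noteq> 0 \<longrightarrow>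
          e (?q t x) * h x ^ (k + l) = A x * h x ^ l + t x * B x"
      proof (intro bexI allI impI)
        show "(\<lambda>x. B x * h x ^ l) \<in> polyfun (m + n)" by (intro polyfun.mult polyfun_power B h')
        fix x assume "h x \<noteq> 0"
        have "e (?q t x) * h x ^ (k + l) = (e (?q t x) * h x ^ k) * h x ^ l"
          by (simp only: power_add mult.assoc)
        also have "\<dots> = A x * h x ^ l + t x * (B x * h x ^ l)"
          unfolding B(2)[OF \<open>h x \<noteq> 0\<close>] by (simp only: distrib_right mult.assoc)
        finally show "e (?q t x) * h x ^ (k + l) = A x * h x ^ l + t x * (B x * h x ^ l)" .
      qed
    qed
  qed
  have "\<exists>k. ?P e k" using e
  proof (induction rule: polyfun.induct)
    case (const c)
    show ?case
      by (rule exI[of _ 0], rule bexI[of _ "\<lambda>x. c"], rule ballI, rule bexI[of _ "\<lambda>x. 0"])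
        (auto intro: polyfun.const)
  next
    case (var i)
    \<comment> \<open>The coordinate is \<open>(G i x + t x * x (m + i)) / h x\<close>, so one
      factor \<open>h\<close> clears it, with \<open>A = G i\<close> and the new variable as
      \<open>B\<close>.\<close>
    then show ?case using G
      by - (rule exI[of _ 1], rule bexI[of _ "G i"], rule ballI, rule bexI[of _ "\<lambda>x. x (m + i)"],
        auto intro: polyfun.var simp: frac_map_def)
  next
    case (add f g)
    then obtain k l where "?P f k" "?P g l" by blast
    then have "?P f (k + l)" "?P g (k + l)"
      using step[of f k l] step[of g l k] by (auto simp: add.commute)
    then obtain A A' where A: "A \<in> polyfun m" "\<forall>t\<in>polyfun m. \<exists>B\<in>polyfun (m + n). \<forall>x. h x \<noteq> 0 \<longrightarrow>
      f (?q t x) * h x ^ (k + l) = A x + t x * B x"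
      and A': "A' \<in> polyfun m" "\<forall>t\<in>polyfun m. \<exists>B\<in>polyfun (m + n). \<forall>x. h x \<noteq> 0 \<longrightarrow>
      g (?q t x) * h x ^ (k + l) = A' x + t x * B x" by blast
    show ?case
    proof (rule exI, rule bexI, rule ballI)
      show "(\<lambda>x. A x + A' x) \<in> polyfun m" by (intro polyfun.add A A')
      fix t :: "(nat \<Rightarrow> 'a) \<Rightarrow> 'a" assume "t \<in> polyfun m"
      then obtain B B' where B: "B \<in> polyfun (m + n)"
          "\<And>x. h x \<noteq> 0 \<Longrightarrow> f (?q t x) * h x ^ (k + l) = A x + t x * B x"
        and B': "B' \<in> polyfun (m + n)"
          "\<And>x. h x \<noteq> 0 \<Longrightarrow> g (?q t x) * h x ^ (k + l) = A' x + t x * B' x"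
        using A A' by meson
      show "\<exists>B\<in>polyfun (m + n). \<forall>x. h x \<noteq> 0 \<longrightarrow>
          (f (?q t x) + g (?q t x)) * h x ^ (k + l) = A x + A' x + t x * B x"
        using B B' by (intro bexI[of _ "\<lambda>x. B x + B' x"] polyfun.add) (auto simp: algebra_simps)
    qed
  next
    case (mult f g)
    then obtain k l A A' where A: "A \<in> polyfun m" "\<forall>t\<in>polyfun m. \<exists>B\<in>polyfun (m + n). \<forall>x. h x \<noteq> 0 \<longrightarrow>
      f (?q t x) * h x ^ k = A x + t x * B x"
      and A': "A' \<in> polyfun m" "\<forall>t\<in>polyfun m. \<exists>B\<in>polyfun (m + n). \<forall>x. h x \<noteq> 0 \<longrightarrow>
      g (?q t x) * h x ^ l = A' x + t x * B x" by blast
    show ?case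
    proof (rule exI[of _ "k + l"], rule bexI, rule ballI)
      show "(\<lambda>x. A x * A' x) \<in> polyfun m" by (intro polyfun.mult A A')
      fix t :: "(nat \<Rightarrow> 'a) \<Rightarrow> 'a" assume t: "t \<in> polyfun m"
      then obtain B B' where B: "B \<in> polyfun (m + n)"
          "\<And>x. h x \<noteq> 0 \<Longrightarrow> f (?q t x) * h x ^ k = A x + t x * B x"
        and B': "B' \<in> polyfun (m + n)"
          "\<And>x. h x \<noteq> 0 \<Longrightarrow> g (?q t x) * h x ^ l = A' x + t x * B' x"
        using A A' by meson
      have lift: "t \<in> polyfun (m + n)" "A \<in> polyfun (m + n)" "A' \<in> polyfun (m + n)"
        using t A A' polyfun_mono by (meson le_add1)+
      show "\<exists>B\<in>polyfun (m + n). \<forall>x. h x \<noteq> 0 \<longrightarrow>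
          (f (?q t x) * g (?q t x)) * h x ^ (k + l) = A x * A' x + t x * B x"
      proof (intro bexI allI impI)
        \<comment> \<open>The coefficient of \<open>t x\<close> when the product of
          \<open>A + t B\<close> and \<open>A' + t B'\<close> is expanded; the term quadratic in
          \<open>t\<close> keeps one factor \<open>t\<close> inside it.\<close>
        show "(\<lambda>x. A x * B' x + A' x * B x + t x * B x * B' x) \<in> polyfun (m + n)"
          by (intro polyfun.add polyfun.mult lift B B')
        fix x assume x: "h x \<noteq> 0"
        have "(f (?q t x) * g (?q t x)) * h x ^ (k + l)
            = (f (?q t x) * h x ^ k) * (g (?q t x) * h x ^ l)"
          by (simp add: power_add)
        also have "\<dots> = (A x + t x * B x) * (A' x + t x * B' x)"
          unfolding B(2)[OF x] B'(2)[OF x] ..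
        also have "\<dots> = A x * A' x + t x * (A x * B' x + A' x * B x + t x * B x * B' x)"
          by (simp add: algebra_simps)
        finally show "(f (?q t x) * g (?q t x)) * h x ^ (k + l)
            = A x * A' x + t x * (A x * B' x + A' x * B x + t x * B x * B' x)" .
      qed
    qed
  qed
  then obtain k where Pk: "?P e k" by blast
  show ?thesis unfolding eventually_sequentially
  proof (rule exI[of _ k], intro allI impI)
    fix K assume "k \<le> K"
    then show "?P e K" using step[OF Pk, of "K - k"] by (simp only: le_add_diff_inverse)
  qed
qed

text \<open>The case \<open>t = 0\<close> of the translated version: the map becomes
  \<open>G/h\<close> and the term with \<open>B\<close> drops out.\<close>

lemma polyfun_frac_map:
  assumes e: "e \<in> polyfun n" and G: "\<And>a. a < n \<Longrightarrow> G a \<in> polyfun m" and h: "h \<in> polyfun m"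
  shows "\<forall>\<^sub>F K in sequentially. \<exists>A\<in>polyfun m. \<forall>x. h x \<noteq> 0 \<longrightarrow>
      e (frac_map n G h x) * h x ^ K = A x"
  using polyfun_translated_frac_map[OF assms]
proof (rule eventually_mono)
  fix K assume "\<exists>A\<in>polyfun m. \<forall>t\<in>polyfun m. \<exists>B\<in>polyfun (m + n). \<forall>x. h x \<noteq> 0 \<longrightarrow>
      e (frac_map n (\<lambda>a x. G a x + t x * x (m + a)) h x) * h x ^ K = A x + t x * B x"
  then obtain A where A: "A \<in> polyfun m" "\<forall>t\<in>polyfun m. \<exists>B\<in>polyfun (m + n). \<forall>x. h x \<noteq> 0 \<longrightarrow>
      e (frac_map n (\<lambda>a x. G a x + t x * x (m + a)) h x) * h x ^ K = A x + t x * B x" by blast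
  show "\<exists>A\<in>polyfun m. \<forall>x. h x \<noteq> 0 \<longrightarrow> e (frac_map n G h x) * h x ^ K = A x"
    using bspec[OF A(2) polyfun.const[of 0 m]] A(1) by auto
qed

text \<open>One power \<open>h ^ K\<close> clears the denominators of \<open>e\<close> and of all
  \<open>H a\<close> after substitution, so it cancels from the quotients
  \<open>H a / e\<close>.\<close>

lemma frac_map_comp:
  assumes H: "\<forall>a<l. H a \<in> polyfun n" and e: "e \<in> polyfun n"
    and G: "\<forall>a<n. G a \<in> polyfun m" and h: "h \<in> polyfun m"
  shows "\<exists>G' h'. h' \<in> polyfun m \<and> (\<forall>a<l. G' a \<in> polyfun m) \<and>
    (\<forall>x. h' x \<noteq> 0 \<longleftrightarrow> h x \<noteq> 0 \<and> e (frac_map n G h x) \<noteq> 0) \<and>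
    (\<forall>x. h' x \<noteq> 0 \<longrightarrow> frac_map l H e (frac_map n G h x) = frac_map l G' h' x)"
proof -
  have "\<forall>\<^sub>F K in sequentially. \<forall>f\<in>insert e (H ` {..<l}). \<exists>A\<in>polyfun m. \<forall>x. h x \<noteq> 0 \<longrightarrow>
      f (frac_map n G h x) * h x ^ K = A x"
    using assms by (intro eventually_ball_finite ballI polyfun_frac_map) auto
  then obtain K where K: "\<forall>f\<in>insert e (H ` {..<l}). \<exists>A\<in>polyfun m. \<forall>x. h x \<noteq> 0 \<longrightarrow>
      f (frac_map n G h x) * h x ^ K = A x"
    using eventually_happens by force
  then obtain A where A: "A \<in> polyfun m"
      "\<And>x. h x \<noteq> 0 \<Longrightarrow> A x = e (frac_map n G h x) * h x ^ K" by (metis insertI1)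
  have "\<forall>a. \<exists>C. a < l \<longrightarrow> C \<in> polyfun m \<and> (\<forall>x. h x \<noteq> 0 \<longrightarrow> H a (frac_map n G h x) * h x ^ K = C x)"
    using K by blast
  then obtain C where C: "\<And>a. a < l \<Longrightarrow> C a \<in> polyfun m"
      "\<And>a x. a < l \<Longrightarrow> h x \<noteq> 0 \<Longrightarrow> C a x = H a (frac_map n G h x) * h x ^ K" by metis
  show ?thesis
  \<comment> \<open>\<open>A\<close> and \<open>C a\<close> are controlled only where
    \<open>h\<close> is nonzero; the extra factor \<open>h\<close> makes the new denominator vanish
    elsewhere.\<close>
  proof (intro exI[of _ "\<lambda>a x. h x * C a x"] exI[of _ "\<lambda>x. h x * A x"] conjI allI impI)
    show "(\<lambda>x. h x * A x) \<in> polyfun m" by (intro polyfun.mult h A)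
    show "(\<lambda>x. h x * C a x) \<in> polyfun m" if "a < l" for a by (intro polyfun.mult h C that)
    show "h x * A x \<noteq> 0 \<longleftrightarrow> h x \<noteq> 0 \<and> e (frac_map n G h x) \<noteq> 0" for x using A(2)[of x] by auto
    fix x assume "h x * A x \<noteq> 0"
    then show "frac_map l H e (frac_map n G h x) = frac_map l (\<lambda>a x. h x * C a x) (\<lambda>x. h x * A x) x"
      using A(2)[of x] C(2)[of _ x] by (auto simp: frac_map_def[of l])
  qed
qed

subsection \<open>Maps to a variety with an affine atlas\<close>

text \<open>Regularity near \<open>p\<close> in the coordinates of a single parametrization
  \<open>\<theta>\<close>. Equating \<open>\<psi> x\<close> with a value of \<open>\<theta>\<close>
  avoids inverse charts and lets the chart vary with \<open>p\<close>.\<close>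

definition rational_at ::
  "nat \<Rightarrow> nat \<Rightarrow> ((nat \<Rightarrow> 'k::field) \<Rightarrow> 'a) \<Rightarrow> ((nat \<Rightarrow> 'k) \<Rightarrow> 'a) \<Rightarrow> (nat \<Rightarrow> 'k) \<Rightarrow> bool" where
  "rational_at m n \<theta> \<psi> p \<longleftrightarrow> (\<exists>G h. h \<in> polyfun m \<and> (\<forall>a<n. G a \<in> polyfun m) \<and> h p \<noteq> 0 \<and>
     (\<forall>x\<in>aff m. h x \<noteq> 0 \<longrightarrow> \<psi> x = \<theta> (frac_map n G h x)))"

lemma rational_atI:
  assumes "h \<in> polyfun m" "\<And>a. a < n \<Longrightarrow> G a \<in> polyfun m" "h p \<noteq> 0"
    "\<And>x. x \<in> aff m \<Longrightarrow> h x \<noteq> 0 \<Longrightarrow> \<psi> x = \<theta> (frac_map n G h x)"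
  shows "rational_at m n \<theta> \<psi> p"
  using assms unfolding rational_at_def by blast

lemma transition_rational_at:
  assumes atlas: "aff_atlas X n r \<phi>" and "i < r" "j < r" "z \<in> chart_dom n \<phi> i j"
  shows "rational_at n n (\<phi> j) (\<phi> i) z"
proof -
  have "regular_map_on n n (chart_dom n \<phi> i j) (\<lambda>x. inv_into (aff n) (\<phi> j) (\<phi> i x))"
    using assms by (simp add: aff_atlas_def)
  from regular_map_common_denominator[OF this assms(4)]
  obtain H e where e: "e \<in> polyfun n" "\<And>a. a < n \<Longrightarrow> H a \<in> polyfun n" "e z \<noteq> 0"
    and eq: "\<And>x. x \<in> aff n \<Longrightarrow> e x \<noteq> 0 \<Longrightarrow> x \<in> chart_dom n \<phi> i j \<and>
      inv_into (aff n) (\<phi> j) (\<phi> i x) = frac_map n H e x" by blast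
  show ?thesis
  proof (rule rational_atI[OF e])
    fix x assume "x \<in> aff n" "e x \<noteq> 0"
    then have "\<phi> i x \<in> \<phi> j ` aff n" "inv_into (aff n) (\<phi> j) (\<phi> i x) = frac_map n H e x"
      using eq by (auto simp: chart_dom_def)
    then show "\<phi> i x = \<phi> j (frac_map n H e x)" by (metis f_inv_into_f)
  qed
qed

text \<open>The point \<open>\<psi> p\<close> lies in both charts, so the transition map is a
  fraction near its coordinates; composing it with the given fraction yields coordinates in the
  chart \<open>i\<close>.\<close>

lemma rational_at_change_chart:
  assumes atlas: "aff_atlas X n r \<phi>" and "i < r" "j < r" "p \<in> aff m"
    and rat: "rational_at m n (\<phi> j) \<psi> p" and im: "\<psi> p \<in> \<phi> i ` aff n"
  shows "rational_at m n (\<phi> i) \<psi> p"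
proof -
  obtain G h where "h \<in> polyfun m" "\<forall>a<n. G a \<in> polyfun m" "h p \<noteq> 0"
    "\<forall>x\<in>aff m. h x \<noteq> 0 \<longrightarrow> \<psi> x = \<phi> j (frac_map n G h x)"
    using rat unfolding rational_at_def by (elim exE conjE)
  note G = this(1-3) this(4)[rule_format]
  have "frac_map n G h p \<in> chart_dom n \<phi> j i"
    using G(3,4) im \<open>p \<in> aff m\<close> by (simp add: chart_dom_def)
  from transition_rational_at[OF atlas \<open>j < r\<close> \<open>i < r\<close> this]
  obtain H e where "e \<in> polyfun n" "\<forall>a<n. H a \<in> polyfun n" "e (frac_map n G h p) \<noteq> 0"
    "\<forall>x\<in>aff n. e x \<noteq> 0 \<longrightarrow> \<phi> j x = \<phi> i (frac_map n H e x)"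
    unfolding rational_at_def by (elim exE conjE)
  note H = this(1-3) this(4)[rule_format]
  obtain G' h' where "h' \<in> polyfun m" "\<forall>a<n. G' a \<in> polyfun m"
    "\<forall>x. h' x \<noteq> 0 \<longleftrightarrow> h x \<noteq> 0 \<and> e (frac_map n G h x) \<noteq> 0"
    "\<forall>x. h' x \<noteq> 0 \<longrightarrow> frac_map n H e (frac_map n G h x) = frac_map n G' h' x"
    using frac_map_comp[of n H n e G m h, OF H(2,1) G(2,1)] by (elim exE conjE)
  note G' = this[rule_format]
  show ?thesis
  proof (rule rational_atI[OF G'(1,2)])
    show "h' p \<noteq> 0" using G'(3) G(3) H(3) by blast
    fix x assume x: "x \<in> aff m" "h' x \<noteq> 0"
    then have "h x \<noteq> 0" "e (frac_map n G h x) \<noteq> 0" using G'(3) by blast+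
    then show "\<psi> x = \<phi> i (frac_map n G' h' x)"
      using G(4)[OF x(1)] H(4)[OF frac_map_in_aff] G'(4)[OF x(2)] by metis
  qed
qed

text \<open>The preimage in the chart \<open>k\<close> is \<open>chart_dom n \<phi> k i\<close>,
  whose openness is part of the regularity of the transition map.\<close>

lemma xopen_chart:
  assumes atlas: "aff_atlas X n r \<phi>" and "i < r"
  shows "xopen X n r \<phi> (\<phi> i ` aff n)"
proof -
  have "zopen n (chart_dom n \<phi> k i)" if "k < r" for k
    using assms that by (simp add: aff_atlas_def regular_map_on_def)
  then show ?thesis using assms unfolding xopen_def chart_dom_def aff_atlas_def by blast
qed

text \<open>One chart near each point suffices: regularity passes to the other charts by
  \<open>rational_at_change_chart\<close>, and continuity follows by pulling back principal open
  sets along fractions.\<close>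

lemma morphism_to_if_rational:
  assumes atlas: "aff_atlas X n r \<phi>"
    and rat: "\<And>p. p \<in> aff m \<Longrightarrow> \<exists>j<r. rational_at m n (\<phi> j) \<psi> p"
  shows "morphism_to m X n r \<phi> \<psi>"
proof -
  have X: "X = (\<Union>i<r. \<phi> i ` aff n)" using atlas by (simp add: aff_atlas_def)
  have im: "\<psi> p \<in> X" if p: "p \<in> aff m" for p
  proof -
    obtain j where j: "j < r" "rational_at m n (\<phi> j) \<psi> p" using rat[OF p] by blast
    then obtain G h where "h p \<noteq> 0" "\<And>x. x \<in> aff m \<Longrightarrow> h x \<noteq> 0 \<Longrightarrow> \<psi> x = \<phi> j (frac_map n G h x)"
      unfolding rational_at_def by blast
    then have "\<psi> p = \<phi> j (frac_map n G h p)" using p by blast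
    then show ?thesis unfolding X using j(1) by (auto intro!: bexI[of _ j])
  qed
  have cont: "zopen m {p \<in> aff m. \<psi> p \<in> U}" if U: "xopen X n r \<phi> U" for U
    unfolding zopen_iff
  proof (intro conjI ballI)
    fix p assume p: "p \<in> {p \<in> aff m. \<psi> p \<in> U}"
    then obtain j where j: "j < r" "rational_at m n (\<phi> j) \<psi> p" using rat by blast
    from j(2)
    obtain G h where "h \<in> polyfun m" "\<forall>a<n. G a \<in> polyfun m" "h p \<noteq> 0"
      "\<forall>x\<in>aff m. h x \<noteq> 0 \<longrightarrow> \<psi> x = \<phi> j (frac_map n G h x)"
      unfolding rational_at_def by (elim exE conjE)
    note G = this(1-3) this(4)[rule_format]
    have "zopen n {x \<in> aff n. \<phi> j x \<in> U}" using U j by (simp add: xopen_def)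
    moreover have "\<psi> p = \<phi> j (frac_map n G h p)" using p G(3,4) by blast
    then have "frac_map n G h p \<in> {x \<in> aff n. \<phi> j x \<in> U}" using p by simp
    ultimately obtain f where f: "f \<in> polyfun n" "f (frac_map n G h p) \<noteq> 0"
      "\<forall>x\<in>aff n. f x \<noteq> 0 \<longrightarrow> x \<in> {x \<in> aff n. \<phi> j x \<in> U}"
      unfolding zopen_iff by blast
    \<comment> \<open>Taking \<open>l = 0\<close> leaves no numerators; only the denominator of the
      composition is wanted, whose nonvanishing locus is the pullback of that of
      \<open>f\<close>.\<close>
    obtain h' where h': "h' \<in> polyfun m" "\<forall>x. h' x \<noteq> 0 \<longleftrightarrow> h x \<noteq> 0 \<and> f (frac_map n G h x) \<noteq> 0"
      using frac_map_comp[of 0 "\<lambda>a. f" n f G m h, OF _ f(1) G(2,1)] by auto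
    have "h' p \<noteq> 0" using h'(2) G(3) f(2) by blast
    moreover have "x \<in> {p \<in> aff m. \<psi> p \<in> U}" if "x \<in> aff m" "h' x \<noteq> 0" for x
      using that h'(2) G(4)[of x] bspec[OF f(3), of "frac_map n G h x"] by simp
    ultimately show "\<exists>f\<in>polyfun m. f p \<noteq> 0 \<and> (\<forall>x\<in>aff m. f x \<noteq> 0 \<longrightarrow> x \<in> {p \<in> aff m. \<psi> p \<in> U})"
      using h'(1) by blast
  qed auto
  have "regular_map_on m n {p \<in> aff m. \<psi> p \<in> \<phi> i ` aff n} (\<lambda>p. inv_into (aff n) (\<phi> i) (\<psi> p))"
    if i: "i < r" for i
    unfolding regular_map_on_def
  proof (intro conjI allI impI)
    show "zopen m {p \<in> aff m. \<psi> p \<in> \<phi> i ` aff n}" using cont xopen_chart[OF atlas i] by blast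
    show "(\<lambda>p. inv_into (aff n) (\<phi> i) (\<psi> p)) ` {p \<in> aff m. \<psi> p \<in> \<phi> i ` aff n} \<subseteq> aff n"
      by (auto intro: inv_into_into)
    fix k assume k: "k < n"
    have inj: "inj_on (\<phi> i) (aff n)" using atlas i by (simp add: aff_atlas_def)
    show "regular_on m {p \<in> aff m. \<psi> p \<in> \<phi> i ` aff n} (\<lambda>x. inv_into (aff n) (\<phi> i) (\<psi> x) k)"
      unfolding regular_on_iff
    proof
      fix p assume p: "p \<in> {p \<in> aff m. \<psi> p \<in> \<phi> i ` aff n}"
      then obtain j where "j < r" "rational_at m n (\<phi> j) \<psi> p" using rat by blast
      then have "rational_at m n (\<phi> i) \<psi> p" using rational_at_change_chart[OF atlas i] p by blast
      then obtain G h where "h \<in> polyfun m" "\<forall>a<n. G a \<in> polyfun m" "h p \<noteq> 0"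
        "\<forall>x\<in>aff m. h x \<noteq> 0 \<longrightarrow> \<psi> x = \<phi> i (frac_map n G h x)"
        unfolding rational_at_def by (elim exE conjE)
      note G = this[rule_format]
      have "\<psi> x \<in> \<phi> i ` aff n \<and> inv_into (aff n) (\<phi> i) (\<psi> x) k = G k x / h x"
        if "x \<in> aff m" "h x \<noteq> 0" for x
        using G(4)[OF that] inj k by (simp add: inv_into_f_f) (simp add: frac_map_def)
      then show "\<exists>g\<in>polyfun m. \<exists>h\<in>polyfun m. p \<in> aff m \<and> h p \<noteq> 0 \<and>
          (\<forall>x\<in>aff m. h x \<noteq> 0 \<longrightarrow> x \<in> {p \<in> aff m. \<psi> p \<in> \<phi> i ` aff n} \<and>
             inv_into (aff n) (\<phi> i) (\<psi> x) k = g x / h x)"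
        using G(1) G(2)[OF k] G(3) p by blast
    qed
  qed
  then show ?thesis unfolding morphism_to_def using im cont by blast
qed

section \<open>Adding one chart to the image of a morphism\<close>

lemma charts_intersect:
  assumes "A_covered X n r \<phi>" "i < r" "j < r"
  shows "chart_dom n \<phi> i j \<noteq> {}"
proof
  assume empty: "chart_dom n \<phi> i j = {}"
  have atlas: "aff_atlas X n r \<phi>" and irr: "irreducible_var X n r \<phi>"
    using assms by (auto simp: A_covered_def)
  have sub: "\<phi> k ` aff n \<subseteq> X" if "k < r" for k using atlas that by (auto simp: aff_atlas_def)
  have closed: "xclosed X n r \<phi> (X - \<phi> k ` aff n)" if "k < r" for k
    using xopen_chart[OF atlas that] sub[OF that] by (simp add: xclosed_def double_diff)
  \<comment> \<open>Disjoint charts would exhibit \<open>X\<close> as the union of two closed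
    complements, against irreducibility.\<close>
  have "X = (X - \<phi> i ` aff n) \<union> (X - \<phi> j ` aff n)"
    using empty unfolding chart_dom_def by blast
  then have "X - \<phi> i ` aff n = X \<or> X - \<phi> j ` aff n = X"
    using irr closed assms unfolding irreducible_var_def by blast
  \<comment> \<open>The origin shows that charts are nonempty, so their complements are proper
    subsets of \<open>X\<close>.\<close>
  moreover have "(\<lambda>k. 0) \<in> aff n" by (simp add: aff_def)
  ultimately show False using sub assms by blast
qed

text \<open>The chart \<open>i\<close> meets every chart in a nonempty open set, and by
  irreducibility of affine space these sets share a point \<open>z\<close>. The product of the
  denominators at \<open>z\<close> of all transitions serves as \<open>e\<close>.\<close>

lemma transitions_common_denominator:
  fixes \<phi> :: "nat \<Rightarrow> (nat \<Rightarrow> 'k::field_char_0) \<Rightarrow> 'a"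
  assumes cov: "A_covered X n r \<phi>" and i: "i < r"
  obtains z H e where "z \<in> aff n" "e \<in> polyfun n" "e z \<noteq> 0"
    "\<And>j a. j < r \<Longrightarrow> a < n \<Longrightarrow> H j a \<in> polyfun n"
    "\<And>j x. j < r \<Longrightarrow> x \<in> aff n \<Longrightarrow> e x \<noteq> 0 \<Longrightarrow> \<phi> i x = \<phi> j (frac_map n (H j) e x)"
proof -
  have atlas: "aff_atlas X n r \<phi>" using cov by (simp add: A_covered_def)
  have "zopen n (chart_dom n \<phi> i j) \<and> chart_dom n \<phi> i j \<noteq> {}" if "j < r" for j
    using charts_intersect[OF cov i that] atlas i that by (simp add: aff_atlas_def regular_map_on_def)
  then obtain z where z: "z \<in> aff n" "\<And>j. j < r \<Longrightarrow> z \<in> chart_dom n \<phi> i j"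
    using zopen_INT_nonempty[of r n "chart_dom n \<phi> i"] by blast
  have "\<exists>H e. j < r \<longrightarrow> e \<in> polyfun n \<and> (\<forall>a<n. H a \<in> polyfun n) \<and> e z \<noteq> 0 \<and>
      (\<forall>x\<in>aff n. e x \<noteq> 0 \<longrightarrow> \<phi> i x = \<phi> j (frac_map n H e x))" for j
    using transition_rational_at[OF atlas i _ z(2), of j] unfolding rational_at_def by blast
  then obtain H e where H: "\<And>j. j < r \<Longrightarrow> e j \<in> polyfun n \<and> (\<forall>a<n. H j a \<in> polyfun n) \<and> e j z \<noteq> 0 \<and>
      (\<forall>x\<in>aff n. e j x \<noteq> 0 \<longrightarrow> \<phi> i x = \<phi> j (frac_map n (H j) (e j) x))"
    by metis
  obtain c where c: "c \<in> polyfun n" "c z \<noteq> 0"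
      "\<forall>j\<in>{..<r}. \<exists>d\<in>polyfun n. \<forall>x. c x = d x * e j x"
    using polyfun_common_multiple[of "{..<r}" e n z] H by auto
  then obtain d where d: "\<And>j. j < r \<Longrightarrow> d j \<in> polyfun n \<and> (\<forall>x. c x = d j x * e j x)"
    by (metis lessThan_iff)
  show thesis
  proof (rule that[OF z(1) c(1,2), of "\<lambda>j a x. d j x * H j a x"])
    show "(\<lambda>x. d j x * H j a x) \<in> polyfun n" if "j < r" "a < n" for j a
      using H d that by (intro polyfun.mult) auto
    fix j x assume x: "j < r" "x \<in> aff n" "c x \<noteq> 0"
    then have "d j x \<noteq> 0" "e j x \<noteq> 0" "c x = d j x * e j x" using d[of j] by auto
    then have "frac_map n (\<lambda>a x. d j x * H j a x) c x = frac_map n (H j) (e j) x"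
      by (auto simp: frac_map_def)
    then show "\<phi> i x = \<phi> j (frac_map n (\<lambda>a x. d j x * H j a x) c x)"
      using H x \<open>e j x \<noteq> 0\<close> by auto
  qed
qed

text \<open>The new map is \<open>\<psi>\<close> on the hypersurface \<open>u = 0\<close> and a
  translation of \<open>\<psi>\<close> in the chart \<open>i\<close> off it. The work lies in
  showing that the two branches fit together as one fraction near each point with
  \<open>u = 0\<close>.\<close>

lemma extend_image_by_chart:
  fixes \<phi> :: "nat \<Rightarrow> (nat \<Rightarrow> 'k::field_char_0) \<Rightarrow> 'a"
  assumes cov: "A_covered X n r \<phi>" and i: "i < r"
    and rat: "\<And>p. p \<in> aff m \<Longrightarrow> \<exists>j<r. rational_at m n (\<phi> j) \<psi> p"
    and dom: "\<phi> 0 ` aff n \<subseteq> \<psi> ` aff m"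
  shows "\<exists>\<psi>'. (\<forall>p\<in>aff (m + n). \<exists>j<r. rational_at (m + n) n (\<phi> j) \<psi>' p) \<and>
           \<psi> ` aff m \<union> \<phi> i ` aff n \<subseteq> \<psi>' ` aff (m + n)"
proof -
  have atlas: "aff_atlas X n r \<phi>" using cov by (simp add: A_covered_def)
  have inj: "inj_on (\<phi> j) (aff n)" if "j < r" for j using atlas that by (simp add: aff_atlas_def)
  have "0 < r" using i by simp
  obtain z H e where z: "z \<in> aff n" "e z \<noteq> 0" and e: "e \<in> polyfun n"
    and H: "\<And>j a. j < r \<Longrightarrow> a < n \<Longrightarrow> H j a \<in> polyfun n"
    and trans: "\<And>j x. j < r \<Longrightarrow> x \<in> aff n \<Longrightarrow> e x \<noteq> 0 \<Longrightarrow> \<phi> i x = \<phi> j (frac_map n (H j) e x)"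
    using transitions_common_denominator[OF cov i] by metis
  \<comment> \<open>The point \<open>z\<close> lies over every chart, in particular over the chart
    0, which \<open>\<psi>\<close> already covers; this provides \<open>p0\<close>.\<close>
  have "\<phi> i z \<in> \<phi> 0 ` aff n" using trans[OF \<open>0 < r\<close> z] by simp
  then obtain p0 where p0: "p0 \<in> aff m" "\<psi> p0 = \<phi> i z" using dom by (metis imageE subsetD)
  then obtain j0 where "j0 < r" "rational_at m n (\<phi> j0) \<psi> p0" using rat by blast
  then have "rational_at m n (\<phi> i) \<psi> p0"
    using rational_at_change_chart[OF atlas i _ p0(1)] p0(2) z(1) by simp
  then obtain G h where h: "h \<in> polyfun m" and G: "\<forall>a<n. G a \<in> polyfun m" and "h p0 \<noteq> 0"
    and \<psi>: "\<forall>x\<in>aff m. h x \<noteq> 0 \<longrightarrow> \<psi> x = \<phi> i (frac_map n G h x)"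
    unfolding rational_at_def by (elim exE conjE)
  note G = G[rule_format] and \<psi> = \<psi>[rule_format]
  have q0: "frac_map n G h p0 = z"
    using \<psi>[OF p0(1) \<open>h p0 \<noteq> 0\<close>] p0(2) inj_onD[OF inj[OF i]] z(1) by (metis frac_map_in_aff)
  let ?q = "\<lambda>t x. frac_map n (\<lambda>a x. G a x + t x * x (m + a)) h x"
  \<comment> \<open>All numerators and the denominator of the transitions, to be cleared by one
    exponent \<open>K\<close>.\<close>
  let ?S = "insert e (\<Union>j<r. \<Union>a<n. {H j a})"
  have "\<forall>\<^sub>F K in sequentially. \<forall>f\<in>?S. \<exists>A\<in>polyfun m. \<forall>t\<in>polyfun m. \<exists>B\<in>polyfun (m + n). \<forall>x.
      h x \<noteq> 0 \<longrightarrow> f (?q t x) * h x ^ K = A x + t x * B x"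
    using e H by (intro eventually_ball_finite ballI polyfun_translated_frac_map h G) auto
  from eventually_happens'[OF sequentially_bot this]
  obtain K where K: "\<forall>f\<in>?S. \<exists>A\<in>polyfun m. \<forall>t\<in>polyfun m. \<exists>B\<in>polyfun (m + n). \<forall>x.
      h x \<noteq> 0 \<longrightarrow> f (?q t x) * h x ^ K = A x + t x * B x"
    by (elim exE)
  obtain A where A: "A \<in> polyfun m" and A': "\<forall>t\<in>polyfun m. \<exists>B\<in>polyfun (m + n). \<forall>x.
      h x \<noteq> 0 \<longrightarrow> e (?q t x) * h x ^ K = A x + t x * B x"
    using bspec[OF K, of e] by blast
  have Aq: "e (frac_map n G h x) * h x ^ K = A x" if "h x \<noteq> 0" for x
    using bspec[OF A' polyfun.const[of 0]] that by auto
  \<comment> \<open>Off \<open>u = 0\<close> the fraction \<open>G/h\<close> is defined and its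
    value lies in the locus \<open>e \<noteq> 0\<close>, where all transitions are known. The
    further factor \<open>A\<close> in \<open>t\<close> gives \<open>A + t B = A (1 + u B)\<close>,
    so that \<open>A\<close> cancels in every chart.\<close>
  define u where "u = (\<lambda>x. h x * A x)"
  define t where "t = (\<lambda>x. u x * A x)"
  have u: "u \<in> polyfun m" and t: "t \<in> polyfun m"
    unfolding u_def t_def by (intro polyfun.mult h A)+
  have lift: "f \<in> polyfun (m + n)" if "f \<in> polyfun m" for f :: "(nat \<Rightarrow> 'k) \<Rightarrow> 'k"
    using polyfun_mono[OF that] by simp
  obtain B where B: "B \<in> polyfun (m + n)"
    and Bq: "\<And>x. h x \<noteq> 0 \<Longrightarrow> e (?q t x) * h x ^ K = A x + t x * B x"
    using A' t by blast
  \<comment> \<open>Projection of A^(m+n) onto the first \<open>m\<close> coordinates.\<close>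
  define tr where "tr = (\<lambda>x k. if k < m then x k else (0::'k))"
  have tr_aff: "tr x \<in> aff m" for x by (simp add: tr_def aff_def)
  have tr: "f (tr x) = f x" if "f \<in> polyfun m" for f x
    by (rule polyfun_cong[OF that]) (simp add: tr_def)
  have tr_frac: "frac_map n F g (tr x) = frac_map n F g x"
    if "g \<in> polyfun m" "\<And>a. a < n \<Longrightarrow> F a \<in> polyfun m" for F g x
    unfolding frac_map_def by (rule ext) (simp add: tr that)
  define \<psi>' where "\<psi>' = (\<lambda>x. if u x = 0 then \<psi> (tr x) else \<phi> i (?q t x))"
  have "\<exists>j<r. rational_at (m + n) n (\<phi> j) \<psi>' p" if p: "p \<in> aff (m + n)" for p
  proof (cases "u p = 0")
    case False
    have "rational_at (m + n) n (\<phi> i) \<psi>' p"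
    proof (rule rational_atI)
      \<comment> \<open>The factor \<open>u\<close>, put into numerators and denominator alike,
        confines the formula to the locus where the second branch of \<open>\<psi>'\<close>
        applies.\<close>
      show "(\<lambda>x. u x * h x) \<in> polyfun (m + n)" by (intro polyfun.mult lift h u)
      show "(\<lambda>x. u x * (G a x + t x * x (m + a))) \<in> polyfun (m + n)" if "a < n" for a
        using that by (intro polyfun.mult polyfun.add lift u t G polyfun.var) auto
      show "u p * h p \<noteq> 0" using False by (simp add: u_def)
      fix x assume x: "u x * h x \<noteq> 0"
      then have "frac_map n (\<lambda>a x. u x * (G a x + t x * x (m + a))) (\<lambda>x. u x * h x) x = ?q t x"
        unfolding frac_map_def by (intro ext) simp
      then show "\<psi>' x = \<phi> i (frac_map n (\<lambda>a x. u x * (G a x + t x * x (m + a))) (\<lambda>x. u x * h x) x)"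
        using x by (simp add: \<psi>'_def)
    qed
    then show ?thesis using i by blast
  next
    case True
    obtain j where j: "j < r" "rational_at m n (\<phi> j) \<psi> (tr p)" using rat tr_aff by blast
    from j(2)
    obtain Y s where s: "s \<in> polyfun m" and Y: "\<forall>a<n. Y a \<in> polyfun m" and sp: "s (tr p) \<noteq> 0"
      and \<psi>Y: "\<forall>x\<in>aff m. s x \<noteq> 0 \<longrightarrow> \<psi> x = \<phi> j (frac_map n Y s x)"
      unfolding rational_at_def by (elim exE conjE)
    note Y = Y[rule_format] and \<psi>Y = \<psi>Y[rule_format]
    \<comment> \<open>\<open>C\<close> and \<open>D\<close> play for the numerator
      \<open>H j a\<close> the roles that \<open>A\<close> and \<open>B\<close> play for
      \<open>e\<close>.\<close>
    let ?Q = "\<lambda>a C D. a < n \<longrightarrow> D \<in> polyfun (m + n) \<and>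
        (\<forall>x. h x \<noteq> 0 \<longrightarrow> H j a (frac_map n G h x) * h x ^ K = C x) \<and>
        (\<forall>x. h x \<noteq> 0 \<longrightarrow> H j a (?q t x) * h x ^ K = C x + t x * D x)"
    have "\<exists>C D. ?Q a C D" for a
    proof (cases "a < n")
      case True
      then obtain C where C: "\<forall>t\<in>polyfun m. \<exists>B\<in>polyfun (m + n). \<forall>x.
          h x \<noteq> 0 \<longrightarrow> H j a (?q t x) * h x ^ K = C x + t x * B x"
        using bspec[OF K, of "H j a"] j(1) by blast
      have "\<forall>x. h x \<noteq> 0 \<longrightarrow> H j a (frac_map n G h x) * h x ^ K = C x"
        using bspec[OF C polyfun.const[of 0]] by auto
      then show ?thesis using bspec[OF C t] by blast
    qed simp
    then have "\<forall>a. \<exists>C D. ?Q a C D" by (rule allI)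
    from choice[OF this] obtain C where "\<forall>a. \<exists>D. ?Q a (C a) D" by (elim exE)
    from choice[OF this] obtain D where "\<forall>a. ?Q a (C a) (D a)" by (elim exE)
    then have D: "\<And>a. a < n \<Longrightarrow> D a \<in> polyfun (m + n)"
      and Cq: "\<And>a x. a < n \<Longrightarrow> h x \<noteq> 0 \<Longrightarrow> H j a (frac_map n G h x) * h x ^ K = C a x"
      and Dq: "\<And>a x. a < n \<Longrightarrow> h x \<noteq> 0 \<Longrightarrow> H j a (?q t x) * h x ^ K = C a x + t x * D a x"
      by simp_all
    have "rational_at (m + n) n (\<phi> j) \<psi>' p"
    proof (rule rational_atI)
      \<comment> \<open>With \<open>y = Y/s\<close> the old coordinates in the chart
        \<open>j\<close>, the new ones are \<open>(y + u D)/(1 + u B)\<close>. Clearing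
        \<open>s\<close> gives this denominator and the numerators below; at \<open>u = 0\<close>
        the formula returns \<open>y\<close>.\<close>
      show "(\<lambda>x. s x * (1 + u x * B x)) \<in> polyfun (m + n)"
        by (intro polyfun.mult polyfun.add polyfun.const lift s u B)
      show "(\<lambda>x. Y a x + s x * (u x * D a x)) \<in> polyfun (m + n)" if "a < n" for a
        using that by (intro polyfun.mult polyfun.add lift s u Y D)
      show "s p * (1 + u p * B p) \<noteq> 0" using True sp tr[OF s] by simp
      fix x assume x: "s x * (1 + u x * B x) \<noteq> 0"
      have \<psi>x: "\<psi> (tr x) = \<phi> j (frac_map n Y s x)"
        using \<psi>Y[OF tr_aff] x tr[OF s] tr_frac[OF s Y] by simp
      show "\<psi>' x = \<phi> j (frac_map n (\<lambda>a x. Y a x + s x * (u x * D a x)) (\<lambda>x. s x * (1 + u x * B x)) x)"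
      proof (cases "u x = 0")
        case True
        then show ?thesis by (simp add: \<psi>'_def \<psi>x frac_map_def cong: if_cong)
      next
        case False
        then have hx: "h x \<noteq> 0" and Ax: "A x \<noteq> 0" by (auto simp: u_def)
        have "e (frac_map n G h x) \<noteq> 0" using Aq[OF hx] Ax by auto
        then have "\<phi> i (frac_map n G h x) = \<phi> j (frac_map n (H j) e (frac_map n G h x))"
          using trans[OF j(1)] by simp
        moreover have "\<psi> (tr x) = \<phi> i (frac_map n G h x)"
          using \<psi>[OF tr_aff] hx tr[OF h] tr_frac[OF h G] by simp
        \<comment> \<open>Two descriptions of \<open>\<psi>\<close> in the chart \<open>j\<close>,
          one through the chart \<open>i\<close> and one direct, agree because the chart is
          injective.\<close>
        ultimately have old: "frac_map n (H j) e (frac_map n G h x) = frac_map n Y s x"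
          using \<psi>x inj_onD[OF inj[OF j(1)]] by (metis frac_map_in_aff)
        have et: "e (?q t x) * h x ^ K = A x * (1 + u x * B x)"
          unfolding Bq[OF hx] by (simp add: t_def algebra_simps)
        then have "e (?q t x) \<noteq> 0" using Ax x by auto
        then have "\<psi>' x = \<phi> j (frac_map n (H j) e (?q t x))"
          using trans[OF j(1)] False by (simp add: \<psi>'_def)
        moreover have "H j a (?q t x) / e (?q t x)
            = (Y a x + s x * (u x * D a x)) / (s x * (1 + u x * B x))" if a: "a < n" for a
        proof -
          have cancel: "b / c = b' / c'" if "b * d = b'" "c * d = c'" "d \<noteq> 0" for b c d b' c' :: 'k
            using that by auto
          \<comment> \<open>At \<open>t = 0\<close> the quotient of the cleared transition is the
            old coordinate \<open>Y a / s\<close>. Thus \<open>C a\<close> is a multiple of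
            \<open>A\<close>, as \<open>t\<close> is, and \<open>A\<close> cancels from the new
            quotient.\<close>
          have "C a x / A x = H j a (frac_map n G h x) / e (frac_map n G h x)"
            by (rule cancel[OF Cq[OF a hx] Aq[OF hx], symmetric]) (simp add: hx)
          also have "\<dots> = Y a x / s x" 
            using fun_cong[OF old, of a] a by (simp add: frac_map_def[of n "H j"] frac_map_def[of n Y])
          finally have CY: "C a x = A x * (Y a x / s x)" using Ax by (simp add: field_simps)
          have "H j a (?q t x) / e (?q t x) = (C a x + t x * D a x) / (A x * (1 + u x * B x))"
            by (rule cancel[OF Dq[OF a hx] et]) (simp add: hx)
          also have "C a x + t x * D a x = A x * (Y a x / s x + u x * D a x)"
            by (simp add: CY t_def algebra_simps)
          also have "A x * (Y a x / s x + u x * D a x) / (A x * (1 + u x * B x))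
              = (Y a x / s x + u x * D a x) / (1 + u x * B x)" using Ax by simp
          also have "Y a x / s x + u x * D a x = (Y a x + s x * (u x * D a x)) / s x"
            using x by (simp add: add_divide_distrib)
          finally show ?thesis by simp
        qed
        then have "frac_map n (H j) e (?q t x)
            = frac_map n (\<lambda>a x. Y a x + s x * (u x * D a x)) (\<lambda>x. s x * (1 + u x * B x)) x"
          by (subst (1 3) frac_map_def) (intro ext, simp)
        ultimately show ?thesis by (simp only:)
      qed
    qed
    then show ?thesis using j(1) by blast
  qed
  \<comment> \<open>Points of A^m have zero translation parameters, so both branches of
    \<open>\<psi>'\<close> return \<open>\<psi> p\<close>.\<close>
  moreover have "\<psi> p \<in> \<psi>' ` aff (m + n)" if p: "p \<in> aff m" for p
  proof -
    have "tr p = p" "p \<in> aff (m + n)" using p by (auto simp: tr_def aff_def)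
    moreover have "?q t p = frac_map n G h p" using p by (auto simp: frac_map_def aff_def)
    ultimately have "\<psi>' p = \<psi> p" using \<psi>[OF p] by (auto simp: \<psi>'_def u_def)
    then show ?thesis using \<open>p \<in> aff (m + n)\<close> by (metis imageI)
  qed
  moreover have "\<phi> i y \<in> \<psi>' ` aff (m + n)" if y: "y \<in> aff n" for y
  proof -
    have "A p0 \<noteq> 0" using Aq[OF \<open>h p0 \<noteq> 0\<close>] q0 z(2) \<open>h p0 \<noteq> 0\<close> by (metis mult_eq_0_iff power_not_zero)
    then have u0: "u p0 \<noteq> 0" and t0: "t p0 \<noteq> 0" using \<open>h p0 \<noteq> 0\<close> by (auto simp: u_def t_def)
    \<comment> \<open>Over the fixed point \<open>p0\<close>, where \<open>t\<close> is nonzero, the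
      last \<open>n\<close> coordinates solve \<open>G + t v = h y\<close> for
      \<open>v\<close>.\<close>
    define x where "x = (\<lambda>k. if k < m then p0 k else
      if k < m + n then (h p0 * y (k - m) - G (k - m) p0) / t p0 else 0)"
    have eq: "f x = f p0" if "f \<in> polyfun m" for f
      by (rule polyfun_cong[OF that]) (simp add: x_def)
    have "?q t x = y"
    proof
      fix a
      show "?q t x a = y a"
        using y t0 \<open>h p0 \<noteq> 0\<close> eq[OF h] eq[OF t] eq[OF G, of a]
        by (auto simp: frac_map_def aff_def) (simp add: x_def)
    qed
    then have "\<psi>' x = \<phi> i y" using u0 eq[OF u] by (simp add: \<psi>'_def)
    moreover have "x \<in> aff (m + n)" by (simp add: x_def aff_def)
    ultimately show ?thesis by (metis imageI)
  qed
  ultimately show ?thesis by (intro exI[of _ \<psi>']) blast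
qed

section \<open>Induction over the charts\<close>

theorem theoremB:
  fixes X :: "'a set" and \<phi> :: "nat \<Rightarrow> (nat \<Rightarrow> 'k::field_char_0) \<Rightarrow> 'a"
  assumes "alg_closed_field TYPE('k)"
    and "A_covered X n r \<phi>"
  shows "A_image X n r \<phi>"
proof -
  have atlas: "aff_atlas X n r \<phi>" using assms by (simp add: A_covered_def)
  then have r: "0 < r" and X: "X = (\<Union>i<r. \<phi> i ` aff n)" by (auto simp: aff_atlas_def)
  \<comment> \<open>The chart 0 is required separately: the union is empty at \<open>k = 0\<close>,
    while \<open>extend_image_by_chart\<close> needs that chart in the image from the start.\<close>
  have "\<exists>m>0. \<exists>\<psi>. (\<forall>p\<in>aff m. \<exists>j<r. rational_at m n (\<phi> j) \<psi> p) \<and>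
      \<phi> 0 ` aff n \<subseteq> \<psi> ` aff m \<and> (\<Union>i<k. \<phi> i ` aff n) \<subseteq> \<psi> ` aff m" if "k \<le> r" for k
    using that
  proof (induction k)
    case 0
    \<comment> \<open>One superfluous coordinate keeps the source dimension positive when \<open>n = 0\<close>.\<close>
    define \<psi> where "\<psi> = (\<lambda>x. \<phi> 0 (frac_map n (\<lambda>a x. x a) (\<lambda>x. 1) x))"
    have "rational_at (Suc n) n (\<phi> 0) \<psi> p" for p
      by (rule rational_atI[of "\<lambda>x. 1" _ _ "\<lambda>a x. x a"])
        (auto intro: polyfun.const polyfun.var simp: \<psi>_def)
    moreover have "\<phi> 0 y \<in> \<psi> ` aff (Suc n)" if "y \<in> aff n" for y
    proof -
      have "y = frac_map n (\<lambda>a x. x a) (\<lambda>x. 1) y" "y \<in> aff (Suc n)"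
        using that by (auto simp: frac_map_def aff_def)
      then show ?thesis unfolding \<psi>_def by (metis (mono_tags, lifting) imageI)
    qed
    ultimately show ?case using r by (intro exI[of _ "Suc n"] conjI exI[of _ \<psi>]) auto
  next
    case (Suc k)
    then obtain m \<psi> where m: "m > 0" and \<psi>: "\<And>p. p \<in> aff m \<Longrightarrow> \<exists>j<r. rational_at m n (\<phi> j) \<psi> p"
      "\<phi> 0 ` aff n \<subseteq> \<psi> ` aff m" "(\<Union>i<k. \<phi> i ` aff n) \<subseteq> \<psi> ` aff m"
      by (meson Suc_leD)
    have "k < r" using Suc.prems by simp
    from extend_image_by_chart[OF assms(2) this \<psi>(1,2)]
    obtain \<psi>' where \<psi>': "\<forall>p\<in>aff (m + n). \<exists>j<r. rational_at (m + n) n (\<phi> j) \<psi>' p"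
      "\<psi> ` aff m \<union> \<phi> k ` aff n \<subseteq> \<psi>' ` aff (m + n)" by blast
    have "\<phi> 0 ` aff n \<subseteq> \<psi>' ` aff (m + n)" "(\<Union>i<Suc k. \<phi> i ` aff n) \<subseteq> \<psi>' ` aff (m + n)"
      using \<psi>(2,3) \<psi>'(2) unfolding lessThan_Suc by blast+
    then show ?case using m \<psi>'(1) by (intro exI[of _ "m + n"] conjI exI[of _ \<psi>']) auto
  qed
  from this[OF order_refl] obtain m \<psi> where m: "m > 0"
    and rat: "\<forall>p\<in>aff m. \<exists>j<r. rational_at m n (\<phi> j) \<psi> p" and cover: "(\<Union>i<r. \<phi> i ` aff n) \<subseteq> \<psi> ` aff m"
    by (elim exE conjE)
  have mor: "morphism_to m X n r \<phi> \<psi>" using morphism_to_if_rational[OF atlas] rat by blast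
  then have "\<psi> ` aff m = X" using cover X by (simp add: morphism_to_def subset_antisym)
  then show ?thesis unfolding A_image_def using m mor by (intro exI[of _ m] exI[of _ \<psi>] conjI)
qed

end
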